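(* Let $(M^n,g,J)$ be a connected complete noncompact Kähler manifold of complex dimension $n\ge3$ with Kähler form $\omega$, let $1\le m<n$, and let $u\in PSH(M)\cap C^{0,1}(M)$ be locally bounded from above. For $t>0$ put $E_t(u)=\{x\in M:u(x)<-t\}$. Assume that there exist constants $A>0$, $\theta\in(0,1)$ and $t_0>0$ such that for every $t\ge t_0$ and every $s>0$, $$\operatorname{Cap}_m(E_{t+s}(u))\le\frac{A}{s^m}\operatorname{Cap}_m(E_t(u))^\theta .$$ Assume in addition that $\operatorname{Cap}_m(E_{t_0}(u))<+\infty$. Then there exist constants $C>0$ and $\beta>0$ such that $$\operatorname{Cap}_m(E_t(u))\le C(1+t)^{-\beta},\qquad t\ge t_0 .$$ More precisely, one may take $\beta=\dfrac{m\theta}{1-\theta}$.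
   Context: $dd^c=i\partial\bar\partial$ up to a fixed positive normalization constant. $PSH(M)$ is the set of plurisubharmonic functions on $M$; $C^{0,1}(M)$ is the set of functions that are globally Lipschitz with respect to the Riemannian distance $d_g$. $SH_m(M)$ is the class of $m$-subharmonic functions on $M$ with respect to $\omega$: a smooth function $v$ is $m$-subharmonic if $(dd^cv)^k\wedge\omega^{n-k}\ge0$ for $1\le k\le m$; in general $v$ is upper semicontinuous, locally integrable, and $dd^cv\wedge dd^cv_1\wedge\cdots\wedge dd^cv_{m-1}\wedge\omega^{n-m}\ge0$ as a current for all smooth $m$-subharmonic $v_1,\dots,v_{m-1}$ (defined locally). For bounded $v\in SH_m(M)$ the positive measure $(dd^cv)^m\wedge\omega^{n-m}$ is defined in the Bedford–Taylor sense. The global $m$-capacity of a compact set $K\subset M$ is $$\operatorname{Cap}_m(K)=\sup\Big\{\int_K(dd^cv)^m\wedge\omega^{n-m}: v\in SH_m(M),\ -1\le v\le0\Big\},$$ and it is extended to arbitrary Borel sets by outer regularization: $\operatorname{Cap}_m(U)=\sup\{\operatorname{Cap}_m(K):K\subset U\text{ compact}\}$ for $U$ open, and $\operatorname{Cap}_m(E)=\inf\{\operatorname{Cap}_m(U):U\supset E\text{ open}\}$ for $E$ Borel. *)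

theory Defs
  imports "HOL-Analysis.Analysis" "HOL-Combinatorics.Permutations"
begin

section \<open>Smooth functions and differential forms on open subsets of complex n-space\<close>

primrec Ck_on :: "nat \<Rightarrow> 'v::real_normed_vector set \<Rightarrow> ('v \<Rightarrow> 'w::real_normed_vector) \<Rightarrow> bool" where
  "Ck_on 0 S f \<longleftrightarrow> continuous_on S f"
| "Ck_on (Suc k) S f \<longleftrightarrow>
     f differentiable_on S \<and> (\<forall>v. Ck_on k S (\<lambda>x. frechet_derivative f (at x) v))"

text \<open>Only used for open sets.\<close>
definition smooth_on :: "'v::real_normed_vector set \<Rightarrow> ('v \<Rightarrow> 'w::real_normed_vector) \<Rightarrow> bool" where
  "smooth_on S f \<longleftrightarrow> (\<forall>k. Ck_on k S f)"

text \<open>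
  A complex-valued form of degree \<open>k\<close> at a point is a function of the list of its \<open>k\<close> argument
  vectors; its values on lists of other lengths are irrelevant. Forms are multilinear over the
  reals, and the complex structure \<open>J\<close> is multiplication by the imaginary unit.
\<close>
type_synonym 'n cform = "(complex^'n) list \<Rightarrow> complex"
type_synonym 'n form_field = "complex^'n \<Rightarrow> 'n cform"

text \<open>
  Forms of bidegree \<open>(p,p)\<close>: among the types \<open>(a,b)\<close> with \<open>a + b = 2p\<close>, on which the rotation
  by \<open>cis t\<close> acts as multiplication by \<open>cis ((a - b) * t)\<close>, exactly \<open>(p,p)\<close> is rotation invariant.
\<close>
definition pp_form :: "nat \<Rightarrow> 'n::finite cform \<Rightarrow> bool" where
  "pp_form p \<alpha> \<longleftrightarrow>
     (\<forall>vs. length vs = 2 * p \<longrightarrow>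
        (\<forall>i<2 * p. linear (\<lambda>x. \<alpha> (vs[i := x]))) \<and>
        (\<forall>i j. i < j \<and> j < 2 * p \<and> vs ! i = vs ! j \<longrightarrow> \<alpha> vs = 0) \<and>
        (\<forall>t. \<alpha> (map (\<lambda>v. cis t *s v) vs) = \<alpha> vs))"

definition wedge :: "nat \<Rightarrow> nat \<Rightarrow> 'n::finite cform \<Rightarrow> 'n cform \<Rightarrow> 'n cform" where
  "wedge k l \<alpha> \<beta> vs =
     (\<Sum>p | p permutes {..<k + l}.
        of_int (sign p) * \<alpha> (map (\<lambda>i. vs ! p i) [0..<k]) * \<beta> (map (\<lambda>i. vs ! p i) [k..<k + l]))
     / (fact k * fact l)"

text \<open>Exterior product of a list of forms of degree 2.\<close>
primrec wedge2 :: "'n::finite cform list \<Rightarrow> 'n cform" where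
  "wedge2 [] = (\<lambda>_. 1)"
| "wedge2 (\<alpha> # \<alpha>s) = wedge 2 (2 * length \<alpha>s) \<alpha> (wedge2 \<alpha>s)"

text \<open>
  Value of a form of top degree on the positively oriented frame
  \<open>e\<^sub>1, J e\<^sub>1, \<dots>, e\<^sub>n, J e\<^sub>n\<close>. It does not depend on the enumeration of the
  index type, because the pairs \<open>e\<^sub>j, J e\<^sub>j\<close> may be permuted without changing the orientation.
\<close>
definition top_coeff :: "'n::finite cform \<Rightarrow> complex" where
  "top_coeff \<alpha> =
     \<alpha> (concat (map (\<lambda>j. [axis j 1, axis j \<i>]) (SOME js. distinct js \<and> set js = UNIV)))"

text \<open>
  \<open>ext_op D\<close> is \<open>d\<close>, \<open>\<partial>\<close> or \<open>\<partial>-bar\<close> according to the directional derivative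
  \<open>D\<close> used: \<open>D f z v\<close> is \<open>df(v)\<close>, \<open>\<partial>f(v)\<close> or \<open>\<partial>-bar f(v)\<close>.
\<close>
definition ext_op ::
  "((complex^'n \<Rightarrow> complex) \<Rightarrow> complex^'n \<Rightarrow> complex^'n \<Rightarrow> complex) \<Rightarrow> 'n::finite form_field \<Rightarrow> 'n form_field"
where
  "ext_op D \<alpha> z vs =
     (\<Sum>i<length vs. (-1) ^ i * D (\<lambda>y. \<alpha> y (take i vs @ drop (Suc i) vs)) z (vs ! i))"

definition ext_d :: "'n::finite form_field \<Rightarrow> 'n form_field" where
  "ext_d = ext_op (\<lambda>f z v. frechet_derivative f (at z) v)"

definition del :: "'n::finite form_field \<Rightarrow> 'n form_field" where
  "del = ext_op (\<lambda>f z v.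
     (frechet_derivative f (at z) v - \<i> * frechet_derivative f (at z) (\<i> *s v)) / 2)"

definition delbar :: "'n::finite form_field \<Rightarrow> 'n form_field" where
  "delbar = ext_op (\<lambda>f z v.
     (frechet_derivative f (at z) v + \<i> * frechet_derivative f (at z) (\<i> *s v)) / 2)"

text \<open>The normalization is \<open>dd\<^sup>c = i \<partial> \<partial>-bar\<close>.\<close>
definition ddc :: "'n::finite form_field \<Rightarrow> 'n form_field" where
  "ddc \<alpha> z vs = \<i> * del (delbar \<alpha>) z vs"

definition fun_form :: "(complex^'n \<Rightarrow> real) \<Rightarrow> 'n::finite form_field" where
  "fun_form f z vs = complex_of_real (f z)"

definition test_forms :: "(complex^'n) set \<Rightarrow> nat \<Rightarrow> 'n::finite form_field set" where
  "test_forms \<Omega> p =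
     {\<phi>. (\<forall>z. pp_form p (\<phi> z)) \<and>
         (\<forall>vs. length vs = 2 * p \<longrightarrow> smooth_on UNIV (\<lambda>z. \<phi> z vs)) \<and>
         (\<exists>K. compact K \<and> K \<subseteq> \<Omega> \<and> (\<forall>z vs. z \<notin> K \<and> length vs = 2 * p \<longrightarrow> \<phi> z vs = 0))}"

definition nonneg_test_funs :: "(complex^'n) set \<Rightarrow> (complex^'n::finite \<Rightarrow> real) set" where
  "nonneg_test_funs \<Omega> =
     {\<psi>. smooth_on UNIV \<psi> \<and> (\<forall>z. 0 \<le> \<psi> z) \<and> (\<exists>K. compact K \<and> K \<subseteq> \<Omega> \<and> (\<forall>z. z \<notin> K \<longrightarrow> \<psi> z = 0))}"

section \<open>Kaehler manifolds\<close>

text \<open>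
  The manifold is the whole type \<open>'a\<close>, and its complex dimension is \<open>CARD('n)\<close>. The metric is
  given in charts: \<open>metric M c z v w\<close> is \<open>g(v, w)\<close> at the point with coordinate \<open>z\<close> in the
  chart \<open>c\<close>, for coordinate vectors \<open>v\<close> and \<open>w\<close>.
\<close>
type_synonym ('a, 'n) chart = "'a set \<times> ('a \<Rightarrow> complex^'n)"

record ('a, 'n::finite) hermitian_structure =
  charts :: "('a, 'n) chart set"
  metric :: "('a, 'n) chart \<Rightarrow> complex^'n \<Rightarrow> complex^'n \<Rightarrow> complex^'n \<Rightarrow> real"

definition chart_image :: "('a, 'n::finite) chart \<Rightarrow> (complex^'n) set" where
  "chart_image c = snd c ` fst c"

definition chart_inv :: "('a, 'n::finite) chart \<Rightarrow> complex^'n \<Rightarrow> 'a" where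
  "chart_inv c = inv_into (fst c) (snd c)"

definition transition :: "('a, 'n::finite) chart \<Rightarrow> ('a, 'n) chart \<Rightarrow> complex^'n \<Rightarrow> complex^'n" where
  "transition c c' = snd c' \<circ> chart_inv c"

definition kform :: "('a, 'n::finite) hermitian_structure \<Rightarrow> ('a, 'n) chart \<Rightarrow> 'n form_field" where
  "kform M c z vs = complex_of_real (metric M c z (\<i> *s (vs ! 0)) (vs ! 1))"

definition complex_atlas ::
  "('a::{t2_space,second_countable_topology}, 'n::finite) chart set \<Rightarrow> bool" where
  "complex_atlas \<A> \<longleftrightarrow>
     (\<Union>c\<in>\<A>. fst c) = UNIV \<and>
     (\<forall>c\<in>\<A>. open (fst c) \<and> open (chart_image c) \<and>
        homeomorphism (fst c) (chart_image c) (snd c) (chart_inv c)) \<and>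
     (\<forall>c\<in>\<A>. \<forall>c'\<in>\<A>. \<forall>z\<in>snd c ` (fst c \<inter> fst c').
        \<exists>D. (transition c c' has_derivative D) (at z) \<and> (\<forall>v. D (\<i> *s v) = \<i> *s D v))"

definition kahler_manifold ::
  "('a::{t2_space,second_countable_topology}, 'n::finite) hermitian_structure \<Rightarrow> bool" where
  "kahler_manifold M \<longleftrightarrow>
     complex_atlas (charts M) \<and>
     (\<forall>c\<in>charts M. \<forall>z\<in>chart_image c.
        bilinear (metric M c z) \<and>
        (\<forall>v w. metric M c z v w = metric M c z w v) \<and>
        (\<forall>v. v \<noteq> 0 \<longrightarrow> 0 < metric M c z v v) \<and>
        (\<forall>v w. metric M c z (\<i> *s v) (\<i> *s w) = metric M c z v w)) \<and>
     (\<forall>c\<in>charts M. \<forall>v w. smooth_on (chart_image c) (\<lambda>z. metric M c z v w)) \<and>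
     (\<forall>c\<in>charts M. \<forall>c'\<in>charts M. \<forall>z\<in>snd c ` (fst c \<inter> fst c'). \<forall>v w.
        metric M c z v w =
        metric M c' (transition c c' z)
          (frechet_derivative (transition c c') (at z) v)
          (frechet_derivative (transition c c') (at z) w)) \<and>
     (\<forall>c\<in>charts M. \<forall>z\<in>chart_image c. \<forall>vs. length vs = 3 \<longrightarrow> ext_d (kform M c) z vs = 0)"

subsection \<open>Riemannian distance\<close>

definition pw_C1_curve ::
  "('a::{t2_space,second_countable_topology}, 'n::finite) hermitian_structure \<Rightarrow> (real \<Rightarrow> 'a) \<Rightarrow> bool" where
  "pw_C1_curve M \<gamma> \<longleftrightarrow>
     continuous_on {0..1} \<gamma> \<and>
     (\<forall>c\<in>charts M. \<forall>a b. 0 \<le> a \<and> a \<le> b \<and> b \<le> 1 \<and> \<gamma> ` {a..b} \<subseteq> fst c \<longrightarrow>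
        (snd c \<circ> \<gamma>) piecewise_C1_differentiable_on {a..b})"

text \<open>
  On a Kaehler manifold the speed does not depend on the chart around \<open>\<gamma> t\<close>. The length is valued
  in \<open>ennreal\<close> because the library's \<open>piecewise_C1_differentiable_on\<close> lets the derivative
  be unbounded near the break points.
\<close>
definition speed ::
  "('a, 'n::finite) hermitian_structure \<Rightarrow> (real \<Rightarrow> 'a) \<Rightarrow> real \<Rightarrow> real" where
  "speed M \<gamma> t =
     (let c = (SOME c. c \<in> charts M \<and> \<gamma> t \<in> fst c);
          v = vector_derivative (snd c \<circ> \<gamma>) (at t)
      in sqrt (metric M c (snd c (\<gamma> t)) v v))"

definition curve_length ::
  "('a, 'n::finite) hermitian_structure \<Rightarrow> (real \<Rightarrow> 'a) \<Rightarrow> ennreal" where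
  "curve_length M \<gamma> = (\<integral>\<^sup>+t\<in>{0..1}. ennreal (speed M \<gamma> t) \<partial>lborel)"

definition riem_dist ::
  "('a::{t2_space,second_countable_topology}, 'n::finite) hermitian_structure \<Rightarrow> 'a \<Rightarrow> 'a \<Rightarrow> real" where
  "riem_dist M p q =
     enn2real (INF \<gamma>\<in>{\<gamma>. pw_C1_curve M \<gamma> \<and> \<gamma> 0 = p \<and> \<gamma> 1 = q}. curve_length M \<gamma>)"

definition complete_manifold ::
  "('a::{t2_space,second_countable_topology}, 'n::finite) hermitian_structure \<Rightarrow> bool" where
  "complete_manifold M \<longleftrightarrow> Metric_space.mcomplete UNIV (riem_dist M)"

definition globally_lipschitz ::
  "('a::{t2_space,second_countable_topology}, 'n::finite) hermitian_structure \<Rightarrow> ('a \<Rightarrow> real) \<Rightarrow> bool" where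
  "globally_lipschitz M u \<longleftrightarrow> (\<exists>L. \<forall>x y. \<bar>u x - u y\<bar> \<le> L * riem_dist M x y)"

section \<open>Plurisubharmonic and m-subharmonic functions\<close>

definition usc :: "('a::topological_space \<Rightarrow> ereal) \<Rightarrow> bool" where
  "usc v \<longleftrightarrow> (\<forall>a. open {x. v x < a})"

definition locally_bounded_above :: "('a::topological_space \<Rightarrow> real) \<Rightarrow> bool" where
  "locally_bounded_above u \<longleftrightarrow> (\<forall>x. \<exists>U. open U \<and> x \<in> U \<and> bdd_above (u ` U))"

text \<open>
  The submean value property on closed complex discs, \<open>f(z)\<close> being at most the mean of \<open>f\<close> over the
  boundary circle. It is written for \<open>B - f \<ge> 0\<close>, where \<open>B\<close> is an upper bound of \<open>f\<close> on the
  disc, so that the integral makes sense also when it is infinite.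
\<close>
definition submean_on_discs :: "(complex^'n::finite) set \<Rightarrow> (complex^'n \<Rightarrow> ereal) \<Rightarrow> bool" where
  "submean_on_discs \<Omega> f \<longleftrightarrow>
     (\<forall>z w B. (\<forall>\<zeta>\<in>cball 0 1. z + \<zeta> *s w \<in> \<Omega> \<and> f (z + \<zeta> *s w) \<le> ereal B) \<longrightarrow>
        (\<integral>\<^sup>+t\<in>{0..2 * pi}. e2ennreal (ereal B - f (z + cis t *s w)) \<partial>lborel)
          \<le> ennreal (2 * pi) * e2ennreal (ereal B - f z))"

definition PSH ::
  "('a::{t2_space,second_countable_topology}, 'n::finite) hermitian_structure \<Rightarrow> ('a \<Rightarrow> ereal) set" where
  "PSH M =
     {v. usc v \<and> (\<forall>x. v x \<noteq> \<infinity>) \<and> (\<exists>x. v x \<noteq> -\<infinity>) \<and>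
         (\<forall>c\<in>charts M. submean_on_discs (chart_image c) (v \<circ> chart_inv c))}"

text \<open>Here \<open>\<omega>\<close> is the coordinate expression of the Kaehler form on the open set \<open>\<Omega>\<close>.\<close>
definition smooth_msh ::
  "'n::finite form_field \<Rightarrow> nat \<Rightarrow> (complex^'n) set \<Rightarrow> (complex^'n \<Rightarrow> real) \<Rightarrow> bool" where
  "smooth_msh \<omega> m \<Omega> v \<longleftrightarrow>
     smooth_on \<Omega> v \<and>
     (\<forall>k. 1 \<le> k \<and> k \<le> m \<longrightarrow> (\<forall>z\<in>\<Omega>.
        top_coeff (wedge2 (replicate k (ddc (fun_form v) z) @ replicate (CARD('n) - k) (\<omega> z)))
          \<in> \<real>\<^sub>\<ge>\<^sub>0))"

text \<open>
  The current \<open>dd\<^sup>c v \<and> dd\<^sup>c v\<^sub>1 \<and> \<dots> \<and> dd\<^sup>c v\<^sub>m\<^sub>-\<^sub>1 \<and> \<omega>\<^sup>n\<^sup>-\<^sup>m\<close> is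
  \<open>dd\<^sup>c\<close> of the current \<open>v dd\<^sup>c v\<^sub>1 \<and> \<dots>\<close>: on a test function \<open>\<psi>\<close> it takes the value
  \<open>\<integral> v dd\<^sup>c \<psi> \<and> dd\<^sup>c v\<^sub>1 \<and> \<dots>\<close>.
\<close>
definition SH ::
  "('a::{t2_space,second_countable_topology}, 'n::finite) hermitian_structure \<Rightarrow> nat \<Rightarrow> ('a \<Rightarrow> ereal) set" where
  "SH M m =
     {v. usc v \<and> (\<forall>x. v x \<noteq> \<infinity>) \<and>
         (\<forall>c\<in>charts M. \<forall>K. compact K \<and> K \<subseteq> chart_image c \<longrightarrow>
            (\<integral>\<^sup>+z\<in>K. e2ennreal \<bar>v (chart_inv c z)\<bar> \<partial>lborel) < \<infinity>) \<and>
         (\<forall>c\<in>charts M. \<forall>\<Omega> ws. open \<Omega> \<and> \<Omega> \<subseteq> chart_image c \<and> length ws = m - 1 \<and>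
            (\<forall>w\<in>set ws. smooth_msh (kform M c) m \<Omega> w) \<longrightarrow>
            (\<forall>\<psi>\<in>nonneg_test_funs \<Omega>.
               (LINT z:\<Omega>|lborel. complex_of_real (real_of_ereal (v (chart_inv c z))) *
                  top_coeff (wedge2 (ddc (fun_form \<psi>) z # map (\<lambda>w. ddc (fun_form w) z) ws @
                     replicate (CARD('n) - m) (kform M c z))))
               \<in> \<real>\<^sub>\<ge>\<^sub>0))}"

section \<open>Bedford--Taylor products and the capacity\<close>

text \<open>
  A current of bidegree \<open>(p,p)\<close> with measure coefficients on \<open>\<Omega>\<close> is represented as \<open>\<tau> \<mu>\<close>, where
  \<open>\<mu>\<close> is a Borel measure that is finite on compact sets and \<open>\<tau>\<close> a locally \<open>\<mu>\<close>-integrable field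
  of \<open>(p,p)\<close>-forms (for example with \<open>\<mu>\<close> the trace measure, or the Lebesgue measure when the current
  is a form). It acts on test forms of bidegree \<open>(n-p,n-p)\<close>, and its product with a bounded Borel
  function \<open>v\<close> is the current \<open>(v \<tau>) \<mu>\<close>, which does not depend on the representation.
\<close>
definition measure_current ::
  "(complex^'n) set \<Rightarrow> nat \<Rightarrow> (complex^'n) measure \<Rightarrow> 'n::finite form_field \<Rightarrow> bool" where
  "measure_current \<Omega> p \<mu> \<tau> \<longleftrightarrow>
     sets \<mu> = sets borel \<and>
     (\<forall>z\<in>\<Omega>. pp_form p (\<tau> z)) \<and>
     (\<forall>K. compact K \<and> K \<subseteq> \<Omega> \<longrightarrow> emeasure \<mu> K < \<infinity> \<and>
        (\<forall>vs. length vs = 2 * p \<longrightarrow> set_integrable \<mu> K (\<lambda>z. \<tau> z vs)))"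

definition current_pairing ::
  "(complex^'n) set \<Rightarrow> nat \<Rightarrow> (complex^'n) measure \<Rightarrow> 'n::finite form_field \<Rightarrow> 'n form_field \<Rightarrow> complex" where
  "current_pairing \<Omega> p \<mu> \<tau> \<phi> =
     (LINT z:\<Omega>|\<mu>. top_coeff (wedge (2 * p) (2 * (CARD('n) - p)) (\<tau> z) (\<phi> z)))"

text \<open>
  The Bedford--Taylor recursion for the currents \<open>T\<^sub>k = (dd\<^sup>c v)\<^sup>k \<and> \<omega>\<^sup>n\<^sup>-\<^sup>m\<close>,
  where \<open>T\<^sub>k = \<tau>s k (\<mu>s k)\<close>: \<open>T\<^sub>0 = \<omega>\<^sup>n\<^sup>-\<^sup>m\<close> and
  \<open>T\<^sub>k\<^sub>+\<^sub>1 = dd\<^sup>c (v T\<^sub>k)\<close> in the sense of currents. It determines the \<open>T\<^sub>k\<close> uniquely.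
\<close>
definition bedford_taylor ::
  "'n::finite form_field \<Rightarrow> nat \<Rightarrow> (complex^'n) set \<Rightarrow> (complex^'n \<Rightarrow> real) \<Rightarrow>
   (nat \<Rightarrow> (complex^'n) measure) \<Rightarrow> (nat \<Rightarrow> 'n form_field) \<Rightarrow> bool" where
  "bedford_taylor \<omega> m \<Omega> v \<mu>s \<tau>s \<longleftrightarrow>
     \<mu>s 0 = lborel \<and> \<tau>s 0 = (\<lambda>z. wedge2 (replicate (CARD('n) - m) (\<omega> z))) \<and>
     (\<forall>k\<le>m. measure_current \<Omega> (CARD('n) - m + k) (\<mu>s k) (\<tau>s k)) \<and>
     (\<forall>k<m. \<forall>\<phi>\<in>test_forms \<Omega> (m - Suc k).
        current_pairing \<Omega> (CARD('n) - m + Suc k) (\<mu>s (Suc k)) (\<tau>s (Suc k)) \<phi> =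
        current_pairing \<Omega> (CARD('n) - m + k) (\<mu>s k)
          (\<lambda>z vs. complex_of_real (v z) * \<tau>s k z vs) (ddc \<phi>))"

text \<open>
  \<open>\<mu>\<close> is the positive measure \<open>(dd\<^sup>c v)\<^sup>m \<and> \<omega>\<^sup>n\<^sup>-\<^sup>m\<close>: in every chart it represents the
  current \<open>T\<^sub>m\<close>. There is at most one such measure.
\<close>
definition hessian_measure ::
  "('a::{t2_space,second_countable_topology}, 'n::finite) hermitian_structure \<Rightarrow> nat \<Rightarrow>
   ('a \<Rightarrow> real) \<Rightarrow> 'a measure \<Rightarrow> bool" where
  "hessian_measure M m v \<mu> \<longleftrightarrow>
     sets \<mu> = sets borel \<and> (\<forall>K. compact K \<longrightarrow> emeasure \<mu> K < \<infinity>) \<and>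
     (\<forall>c\<in>charts M. \<exists>\<mu>s \<tau>s.
        bedford_taylor (kform M c) m (chart_image c) (v \<circ> chart_inv c) \<mu>s \<tau>s \<and>
        (\<forall>\<psi>\<in>test_forms (chart_image c) 0.
           (LINT x:fst c|\<mu>. \<psi> (snd c x) []) =
           current_pairing (chart_image c) CARD('n) (\<mu>s m) (\<tau>s m) \<psi>))"

definition Cap_compact ::
  "('a::{t2_space,second_countable_topology}, 'n::finite) hermitian_structure \<Rightarrow> nat \<Rightarrow> 'a set \<Rightarrow> ennreal" where
  "Cap_compact M m K =
     Sup {emeasure \<mu> K | v \<mu>.
            (\<lambda>x. ereal (v x)) \<in> SH M m \<and> (\<forall>x. -1 \<le> v x \<and> v x \<le> 0) \<and> hessian_measure M m v \<mu>}"

definition Cap_open ::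
  "('a::{t2_space,second_countable_topology}, 'n::finite) hermitian_structure \<Rightarrow> nat \<Rightarrow> 'a set \<Rightarrow> ennreal" where
  "Cap_open M m U = (SUP K\<in>{K. compact K \<and> K \<subseteq> U}. Cap_compact M m K)"

definition Cap ::
  "('a::{t2_space,second_countable_topology}, 'n::finite) hermitian_structure \<Rightarrow> nat \<Rightarrow> 'a set \<Rightarrow> ennreal" where
  "Cap M m E = (INF U\<in>{U. open U \<and> E \<subseteq> U}. Cap_open M m U)"

definition sublevel :: "('a \<Rightarrow> real) \<Rightarrow> real \<Rightarrow> 'a set" where
  "sublevel u t = {x. u x < - t}"

text \<open>Real powers of extended nonnegative reals, for exponents \<open>a > 0\<close>.\<close>
definition ennreal_powr :: "ennreal \<Rightarrow> real \<Rightarrow> ennreal" where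
  "ennreal_powr x a = (if x = top then top else ennreal (enn2real x powr a))"

end

theory Submission
  imports Defs
begin

text \<open>
  Let \<open>f t\<close> be the capacity of \<open>{u < -t}\<close>. The capacity is monotone, so \<open>f\<close> is finite and bounded by
  \<open>f t\<^sub>0\<close> beyond \<open>t\<^sub>0\<close>, and the claim becomes one about a nonnegative real function with
  \<open>f (t + s) \<le> A / s ^ m * f t powr \<theta>\<close>.

  Because \<open>f\<close> occurs on the right with a power \<open>\<theta> < 1\<close>, the inequality contracts towards the
  power law that it preserves. Doubling the level, that is \<open>s = t\<close>, sends a bound
  \<open>N * t powr -\<gamma>\<close> to a multiple of \<open>t powr -(m + \<gamma> * \<theta>)\<close>, so the exponent is reproduced exactly
  when \<open>\<gamma> = m / (1 - \<theta>)\<close>. The constant is then mapped to \<open>A * 2 powr \<gamma> * N powr \<theta>\<close>, which is at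
  most \<open>N\<close> once \<open>N\<close> is large, again because \<open>\<theta> < 1\<close>. A bound on \<open>[t\<^sub>0, 2 t\<^sub>0]\<close> thus propagates to
  all levels along dyadic intervals (lemma \<open>powr_decay_if_doubling_gain\<close>). The resulting exponent
  \<open>m / (1 - \<theta>)\<close> exceeds the required \<open>m * \<theta> / (1 - \<theta>)\<close>; passing from \<open>t\<close> to \<open>1 + t\<close> costs only
  a constant since \<open>t \<ge> t\<^sub>0 > 0\<close>.
\<close>

lemma Cap_mono: "E \<subseteq> F \<Longrightarrow> Cap M m E \<le> Cap M m F"
  unfolding Cap_def by (rule INF_superset_mono) auto

lemma sublevel_antimono: "s \<le> t \<Longrightarrow> sublevel u t \<subseteq> sublevel u s"
  unfolding sublevel_def by auto

text \<open>
  The exponent \<open>m / (1 - \<theta>)\<close> is the solution of \<open>\<gamma> = m + \<gamma> * \<theta>\<close>, the condition for the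
  inequality to carry a bound \<open>N * t powr -\<gamma>\<close> at level \<open>t\<close> to one of the same form at level \<open>2 t\<close>.
\<close>
lemma powr_decay_if_doubling_gain:
  fixes f :: "real \<Rightarrow> real" and A \<theta> t\<^sub>0 :: real and m :: nat
  assumes "0 < A" "0 < \<theta>" "\<theta> < 1" "0 < t\<^sub>0"
    and nonneg: "\<And>t. 0 \<le> f t"
    and bounded: "\<And>t. t\<^sub>0 \<le> t \<Longrightarrow> f t \<le> f t\<^sub>0"
    and gain: "\<And>t s. t\<^sub>0 \<le> t \<Longrightarrow> 0 < s \<Longrightarrow> f (t + s) \<le> A / s ^ m * f t powr \<theta>"
  obtains C where "0 < C" "\<And>t. t\<^sub>0 \<le> t \<Longrightarrow> f t \<le> C * t powr - (real m / (1 - \<theta>))"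
proof
  define \<gamma> where "\<gamma> = real m / (1 - \<theta>)"
  have \<gamma>: "0 \<le> \<gamma>" "real m + \<gamma> * \<theta> = \<gamma>"
    using assms(3) by (auto simp: \<gamma>_def field_simps)
  \<comment> \<open>The first entry bounds \<open>f\<close> on \<open>[t\<^sub>0, 2 t\<^sub>0]\<close>; the second is the fixed point of
    \<open>N \<mapsto> A * 2 powr \<gamma> * N powr \<theta>\<close>, above which this map decreases its argument.\<close>
  define N where "N = max (f t\<^sub>0 * (2 * t\<^sub>0) powr \<gamma>) ((A * 2 powr \<gamma>) powr (1 / (1 - \<theta>)))"
  have "0 < (A * 2 powr \<gamma>) powr (1 / (1 - \<theta>))"
    using assms(1) by simp
  then show "0 < N"
    unfolding N_def by linarith
  have "A * 2 powr \<gamma> = ((A * 2 powr \<gamma>) powr (1 / (1 - \<theta>))) powr (1 - \<theta>)"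
    using assms(1,3) by (simp add: powr_powr)
  also have "\<dots> \<le> N powr (1 - \<theta>)"
    using assms(3) by (intro powr_mono2) (auto simp: N_def)
  finally have "A * 2 powr \<gamma> * N powr \<theta> \<le> N powr (1 - \<theta>) * N powr \<theta>"
    by (rule mult_right_mono) simp
  then have N: "A * 2 powr \<gamma> * N powr \<theta> \<le> N"
    using \<open>0 < N\<close> by (simp flip: powr_add)
  have dyadic: "f t \<le> N * t powr - \<gamma>" if "t\<^sub>0 \<le> t" "t \<le> 2 ^ Suc k * t\<^sub>0" for k t
    using that
  proof (induction k arbitrary: t)
    case 0
    have "f t * t powr \<gamma> \<le> f t\<^sub>0 * (2 * t\<^sub>0) powr \<gamma>"
      using 0 assms(4) \<gamma>(1) nonneg bounded by (intro mult_mono powr_mono2) auto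
    also have "\<dots> \<le> N"
      by (simp add: N_def)
    finally show ?case
      using 0 assms(4) by (simp add: powr_minus field_simps)
  next
    case (Suc k)
    show ?case
    proof (cases "t \<le> 2 ^ Suc k * t\<^sub>0")
      case True
      with Suc show ?thesis by blast
    next
      case False
      define r where "r = t / 2"
      have "2 * t\<^sub>0 \<le> 2 ^ Suc k * t\<^sub>0"
        using assms(4) by (intro mult_right_mono) auto
      with False have "2 * t\<^sub>0 \<le> t"
        by linarith
      then have r: "t\<^sub>0 \<le> r" "r \<le> 2 ^ Suc k * t\<^sub>0" "0 < r" "t = r + r"
        using Suc.prems assms(4) by (auto simp: r_def)
      have "f t \<le> A / r ^ m * f r powr \<theta>"
        using gain[OF r(1,3)] r(4) by simp
      also have "\<dots> \<le> A / r ^ m * (N * r powr - \<gamma>) powr \<theta>"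
        using Suc.IH[OF r(1,2)] nonneg assms(1,2) r(3) by (intro mult_left_mono powr_mono2) auto
      also have "\<dots> = A * N powr \<theta> * r powr - (real m + \<gamma> * \<theta>)"
        using r(3) \<open>0 < N\<close>
        by (simp add: powr_powr powr_divide powr_diff powr_minus powr_realpow field_simps)
      also have "\<dots> = A * 2 powr \<gamma> * N powr \<theta> * t powr - \<gamma>"
        unfolding \<gamma>(2) using Suc.prems assms(4)
        by (simp add: r_def powr_divide powr_minus field_simps)
      also have "\<dots> \<le> N * t powr - \<gamma>"
        using N by (rule mult_right_mono) simp
      finally show ?thesis .
    qed
  qed
  show "f t \<le> N * t powr - (real m / (1 - \<theta>))" if "t\<^sub>0 \<le> t" for t
  proof -
    obtain k where "t / t\<^sub>0 < 2 ^ k"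
      using real_arch_pow[of 2 "t / t\<^sub>0"] by auto
    also have "(2::real) ^ k \<le> 2 ^ Suc k"
      by simp
    finally have "t \<le> 2 ^ Suc k * t\<^sub>0"
      using assms(4) by (simp add: field_simps)
    with dyadic that show ?thesis
      unfolding \<gamma>_def by blast
  qed
qed

text \<open>
  The shift is harmless because \<open>1 + t\<close> is at most \<open>(1 + 1 / t\<^sub>0) * t\<close> for \<open>t \<ge> t\<^sub>0\<close>, and the
  exponent may be lowered because \<open>1 + t\<close>, unlike \<open>t\<close>, is never below \<open>1\<close>.
\<close>
lemma powr_minus_le_shift:
  fixes t t\<^sub>0 \<beta> \<gamma> :: real
  assumes "0 < t\<^sub>0" "t\<^sub>0 \<le> t" "0 \<le> \<beta>" "\<beta> \<le> \<gamma>"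
  shows "t powr - \<gamma> \<le> (1 + 1 / t\<^sub>0) powr \<gamma> * (1 + t) powr - \<beta>"
proof -
  have "1 + t \<le> (1 + 1 / t\<^sub>0) * t"
    using assms(1,2) by (simp add: field_simps)
  then have "(1 + t) powr \<gamma> \<le> ((1 + 1 / t\<^sub>0) * t) powr \<gamma>"
    using assms by (intro powr_mono2) auto
  also have "\<dots> = (1 + 1 / t\<^sub>0) powr \<gamma> * t powr \<gamma>"
    using assms by (simp add: powr_mult)
  finally have "t powr - \<gamma> \<le> (1 + 1 / t\<^sub>0) powr \<gamma> * (1 + t) powr - \<gamma>"
    using assms(1,2) by (simp add: powr_minus field_simps)
  also have "\<dots> \<le> (1 + 1 / t\<^sub>0) powr \<gamma> * (1 + t) powr - \<beta>"
    using assms by (intro mult_left_mono powr_mono) auto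
  finally show ?thesis .
qed

theorem theorem3p5:
  fixes M :: "('a::{t2_space,second_countable_topology}, 'n::finite) hermitian_structure"
    and u :: "'a \<Rightarrow> real" and m :: nat and A \<theta> t\<^sub>0 :: real
  assumes "kahler_manifold M"
    and "connected (UNIV :: 'a set)"
    and "complete_manifold M"
    and "\<not> compact (UNIV :: 'a set)"
    and "3 \<le> CARD('n)"
    and "1 \<le> m" and "m < CARD('n)"
    and "(\<lambda>x. ereal (u x)) \<in> PSH M"
    and "globally_lipschitz M u"
    and "locally_bounded_above u"
    and "0 < A" and "0 < \<theta>" and "\<theta> < 1" and "0 < t\<^sub>0"
    and "\<And>t s. t\<^sub>0 \<le> t \<Longrightarrow> 0 < s \<Longrightarrow>
           Cap M m (sublevel u (t + s)) \<le> ennreal (A / s ^ m) * ennreal_powr (Cap M m (sublevel u t)) \<theta>"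
    and "Cap M m (sublevel u t\<^sub>0) < \<infinity>"
  shows "(\<exists>C>0. \<exists>\<beta>>0. \<forall>t\<ge>t\<^sub>0. Cap M m (sublevel u t) \<le> ennreal (C * (1 + t) powr (- \<beta>))) \<and>
         (\<exists>C>0. \<forall>t\<ge>t\<^sub>0. Cap M m (sublevel u t)
            \<le> ennreal (C * (1 + t) powr (- (real m * \<theta> / (1 - \<theta>)))))"
proof -
  define f where "f t = enn2real (Cap M m (sublevel u t))" for t
  define \<beta> where "\<beta> = real m * \<theta> / (1 - \<theta>)"
  define \<gamma> where "\<gamma> = real m / (1 - \<theta>)"
  have mono: "Cap M m (sublevel u t) \<le> Cap M m (sublevel u t\<^sub>0)" if "t\<^sub>0 \<le> t" for t
    using that by (intro Cap_mono sublevel_antimono)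
  have Cap_eq: "Cap M m (sublevel u t) = ennreal (f t)" if "t\<^sub>0 \<le> t" for t
    using mono[OF that] \<open>Cap M m (sublevel u t\<^sub>0) < \<infinity>\<close> by (simp add: f_def)
  have nonneg: "0 \<le> f t" for t
    by (simp add: f_def)
  have bounded: "f t \<le> f t\<^sub>0" if "t\<^sub>0 \<le> t" for t
    using mono[OF that] that by (simp add: Cap_eq nonneg)
  have gain: "f (t + s) \<le> A / s ^ m * f t powr \<theta>" if "t\<^sub>0 \<le> t" "0 < s" for t s
  proof -
    have "ennreal (f (t + s)) \<le> ennreal (A / s ^ m) * ennreal (f t powr \<theta>)"
      using assms(15)[OF that] that by (simp add: Cap_eq ennreal_powr_def nonneg)
    also have "\<dots> = ennreal (A / s ^ m * f t powr \<theta>)"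
      using that \<open>0 < A\<close> by (intro ennreal_mult[symmetric]) auto
    finally show ?thesis
      using that \<open>0 < A\<close> by (subst (asm) ennreal_le_iff) auto
  qed
  obtain C where C: "0 < C" "\<And>t. t\<^sub>0 \<le> t \<Longrightarrow> f t \<le> C * t powr - \<gamma>"
    using powr_decay_if_doubling_gain[of A \<theta> t\<^sub>0 f m] assms(11-14) nonneg bounded gain
    unfolding \<gamma>_def by blast
  define D where "D = C * (1 + 1 / t\<^sub>0) powr \<gamma>"
  have "0 < 1 + 1 / t\<^sub>0"
    using \<open>0 < t\<^sub>0\<close> by (simp add: add_pos_pos)
  then have "0 < D"
    using C(1) by (simp add: D_def)
  have \<beta>: "0 < \<beta>" "\<beta> \<le> \<gamma>"
    using \<open>1 \<le> m\<close> \<open>0 < \<theta>\<close> \<open>\<theta> < 1\<close> by (auto simp: \<beta>_def \<gamma>_def divide_simps)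
  have "Cap M m (sublevel u t) \<le> ennreal (D * (1 + t) powr - \<beta>)" if "t\<^sub>0 \<le> t" for t
  proof -
    have "f t \<le> C * t powr - \<gamma>"
      using C(2) that .
    also have "\<dots> \<le> C * ((1 + 1 / t\<^sub>0) powr \<gamma> * (1 + t) powr - \<beta>)"
      using powr_minus_le_shift[OF \<open>0 < t\<^sub>0\<close> that _ \<beta>(2)] \<beta>(1) C(1) by simp
    finally show ?thesis
      using that by (simp add: Cap_eq D_def mult.assoc ennreal_leI)
  qed
  then show ?thesis
    using \<open>0 < D\<close> \<beta>(1) unfolding \<beta>_def by blast
qed

end
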